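(* Let $\{k_n\}_{n=0}^\infty$ be a building sequence, with associated limits $a$ and $b$, of the family of random multi-hooking networks $\{G_n\}_{n\ge 1}$, starting from a seed $G_0$ with $\tau_0\ge 2$ vertices and total path length $T_0$. Let $D_n$ be the depth of a uniformly randomly selected node in the $n$th network $G_n$. Then $$\mathbb{E}[D_n]=\frac{a\,T_0}{\tau_0-1+ab}\,n+o(n),\qquad\text{as } n\to\infty.$$
   Context: Seed. $G_0$ is a connected finite graph (loops and multiple edges are allowed) with $\tau_0\ge 2$ vertices, one of which is designated as the hook $h$. Building sequence. A sequence of integers $\{k_n\}_{n=0}^\infty$ with $k_n\ge 1$ is a building sequence (for a seed of order $\tau_0$) if: (i) $k_n\le \tau_0+(\tau_0-1)\sum_{i=0}^{n-1}k_i$ for all $n\ge 0$; (ii) the limit $a:=\lim_{n\to\infty} k_n/\sum_{i=0}^n k_i$ exists in $[0,1]$; (iii) the limit $b:=\lim_{n\to\infty}\tau_0/k_n\ge 0$ exists. Random multi-hooking network. For $n\ge 1$, given $G_{n-1}=(V_{n-1},\mathcal{E}_{n-1})$, a set of $k_{n-1}$ distinct vertices of $G_{n-1}$, called latches, is chosen uniformly at random among all subsets of $V_{n-1}$ of size $k_{n-1}$ (given the whole past). For each latch a fresh copy of the seed is taken and its hook is fused (identified) with the latch; distinct latches receive distinct copies. The result is $G_n$. Depth. The reference vertex of $G_n$ is the hook of the initial seed $G_0$ (viewed as a vertex of $G_n$). The depth of a vertex of $G_n$ is its graph distance in $G_n$ (number of edges on a shortest path) to the reference vertex. The total path length $T_0$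 of the seed is the sum of the depths of all vertices of $G_0$. Given $G_n$, the node whose depth is $D_n$ is chosen uniformly among the vertices of $G_n$. *)

theory Defs
  imports "HOL-Probability.Probability" "HOL-Library.Uprod" "HOL-Library.Landau_Symbols"
begin

text \<open>Undirected multigraphs: an edge is an unordered pair of (possibly equal) end vertices, so loops
  are allowed, and multiple edges are recorded by multiplicity.\<close>

record 'v multigraph =
  verts :: "'v set"
  edges :: "'v uprod multiset"

definition finite_multigraph :: "'v multigraph \<Rightarrow> bool" where
  "finite_multigraph G \<longleftrightarrow> finite (verts G) \<and> (\<forall>e \<in># edges G. set_uprod e \<subseteq> verts G)"

definition adjacent :: "'v multigraph \<Rightarrow> 'v \<Rightarrow> 'v \<Rightarrow> bool" where
  "adjacent G u v \<longleftrightarrow> Upair u v \<in># edges G"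

definition is_path :: "'v multigraph \<Rightarrow> 'v \<Rightarrow> 'v list \<Rightarrow> 'v \<Rightarrow> bool" where
  "is_path G u p v \<longleftrightarrow>
     p \<noteq> [] \<and> hd p = u \<and> last p = v \<and> set p \<subseteq> verts G \<and> distinct p \<and> successively (adjacent G) p"

definition connected_multigraph :: "'v multigraph \<Rightarrow> bool" where
  "connected_multigraph G \<longleftrightarrow>
     verts G \<noteq> {} \<and> (\<forall>u \<in> verts G. \<forall>v \<in> verts G. \<exists>p. is_path G u p v)"

text \<open>A path is given by its vertices, so it has \<open>length p - 1\<close> edges. The value is meaningful only
  if \<open>u\<close> and \<open>v\<close> are joined by a path.\<close>

definition graph_dist :: "'v multigraph \<Rightarrow> 'v \<Rightarrow> 'v \<Rightarrow> nat" where
  "graph_dist G u v = (LEAST d. \<exists>p. is_path G u p v \<and> length p - 1 = d)"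

definition total_path_length :: "'v multigraph \<Rightarrow> 'v \<Rightarrow> nat" where
  "total_path_length G r = (\<Sum>v \<in> verts G. graph_dist G v r)"

definition is_seed :: "'v multigraph \<Rightarrow> 'v \<Rightarrow> bool" where
  "is_seed G0 h \<longleftrightarrow>
     finite_multigraph G0 \<and> connected_multigraph G0 \<and> card (verts G0) \<ge> 2 \<and> h \<in> verts G0"

definition building_sequence :: "nat \<Rightarrow> (nat \<Rightarrow> nat) \<Rightarrow> bool" where
  "building_sequence \<tau>0 k \<longleftrightarrow>
     (\<forall>n. k n \<ge> 1) \<and>
     (\<forall>n. k n \<le> \<tau>0 + (\<tau>0 - 1) * (\<Sum>i<n. k i)) \<and>
     (\<exists>a \<in> {0..1::real}. (\<lambda>n. real (k n) / real (\<Sum>i\<le>n. k i)) \<longlonglongrightarrow> a) \<and>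
     (\<exists>b \<ge> (0::real). (\<lambda>n. real \<tau>0 / real (k n)) \<longlonglongrightarrow> b)"

text \<open>Canonical names for the vertices of the networks. \<open>Orig v\<close> is the vertex \<open>v\<close> of the initial
  seed. \<open>Copy n x v\<close> is the non-hook vertex \<open>v\<close> in the copy of the seed hooked at the latch \<open>x\<close> when
  the \<open>n\<close>th network is turned into the next one. As a vertex is a latch at most once in each step,
  this makes all copies fresh and distinct.\<close>

datatype 'a vertex = Orig 'a | Copy nat "'a vertex" 'a

definition copy_vertex :: "'a \<Rightarrow> nat \<Rightarrow> 'a vertex \<Rightarrow> 'a \<Rightarrow> 'a vertex" where
  "copy_vertex h n x v = (if v = h then x else Copy n x v)"

definition initial_network :: "'a multigraph \<Rightarrow> 'a vertex multigraph" where
  "initial_network G0 =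
     \<lparr>verts = Orig ` verts G0, edges = image_mset (map_uprod Orig) (edges G0)\<rparr>"

definition fuse_copies ::
  "'a multigraph \<Rightarrow> 'a \<Rightarrow> nat \<Rightarrow> 'a vertex set \<Rightarrow> 'a vertex multigraph \<Rightarrow> 'a vertex multigraph" where
  "fuse_copies G0 h n L G =
     \<lparr>verts = verts G \<union> (\<Union>x\<in>L. copy_vertex h n x ` verts G0),
      edges = edges G + (\<Sum>x\<in>L. image_mset (map_uprod (copy_vertex h n x)) (edges G0))\<rparr>"

text \<open>The law of the \<open>n\<close>th network. The past of the process can be read off from the vertex names,
  and the step from \<open>n\<close> to \<open>Suc n\<close> is the conditional law given that past.\<close>

fun network :: "'a multigraph \<Rightarrow> 'a \<Rightarrow> (nat \<Rightarrow> nat) \<Rightarrow> nat \<Rightarrow> 'a vertex multigraph pmf" where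
  "network G0 h k 0 = return_pmf (initial_network G0)"
| "network G0 h k (Suc n) =
     bind_pmf (network G0 h k n) (\<lambda>G.
       map_pmf (\<lambda>L. fuse_copies G0 h n L G)
         (pmf_of_set {L. L \<subseteq> verts G \<and> card L = k n}))"

definition depth :: "'a \<Rightarrow> 'a vertex multigraph \<Rightarrow> 'a vertex \<Rightarrow> nat" where
  "depth h G v = graph_dist G v (Orig h)"

text \<open>The law of the depth \<open>D\<^sub>n\<close> of a uniformly chosen vertex of the \<open>n\<close>th network.\<close>

definition node_depth :: "'a multigraph \<Rightarrow> 'a \<Rightarrow> (nat \<Rightarrow> nat) \<Rightarrow> nat \<Rightarrow> nat pmf" where
  "node_depth G0 h k n =
     bind_pmf (network G0 h k n) (\<lambda>G. map_pmf (depth h G) (pmf_of_set (verts G)))"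

end

theory Submission
  imports Defs
begin

text \<open>Every path from a copy of the seed to the reference vertex passes through the hook of that copy,
  so depths never change once a vertex is present, and a new vertex has the depth of its latch plus
  its depth in the seed. Writing \<open>N\<^sub>n\<close> for the order of the \<open>n\<close>th network and \<open>S\<^sub>n\<close> for the sum of its
  depths, a uniform choice of \<open>k\<^sub>n\<close> latches gives
  \<open>E S\<^sub>n\<^sub>+\<^sub>1 = (N\<^sub>n\<^sub>+\<^sub>1 / N\<^sub>n) E S\<^sub>n + k\<^sub>n T\<^sub>0\<close>. Hence the mean depth increases by \<open>k\<^sub>n T\<^sub>0 / N\<^sub>n\<^sub>+\<^sub>1\<close>,
  which converges to \<open>a T\<^sub>0 / (\<tau>\<^sub>0 - 1 + a b)\<close>, and averaging the increments gives the claim.\<close>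

text \<open>A function with these properties is the distance to \<open>r\<close> (\<open>graph_dist_eq_potential\<close>); unlike
  distances, they are checked locally, so they survive the fusion of copies.\<close>

definition distance_potential :: "'v multigraph \<Rightarrow> 'v \<Rightarrow> ('v \<Rightarrow> nat) \<Rightarrow> bool" where
  "distance_potential G r f \<longleftrightarrow>
     r \<in> verts G \<and> f r = 0 \<and> (\<forall>u v. adjacent G u v \<longrightarrow> f u \<le> f v + 1) \<and>
     (\<forall>v \<in> verts G. v \<noteq> r \<longrightarrow> (\<exists>u \<in> verts G. adjacent G v u \<and> f v = f u + 1))"

section \<open>Paths, distances and potentials in multigraphs\<close>

lemma adjacent_sym: "adjacent G u v \<Longrightarrow> adjacent G v u"
proof -
  have "Upair u v = Upair v u" by simp
  then show "adjacent G u v \<Longrightarrow> adjacent G v u" by (simp add: adjacent_def)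
qed

text \<open>\<open>Upair\<close> forgets the order of its arguments, so the ends of a preimage edge
  may match \<open>u\<close> and \<open>v\<close> crosswise; symmetry of adjacency lets them be
  named in the matching order.\<close>

lemma adjacent_map_edges:
  assumes "Upair u v \<in># image_mset (map_uprod f) (edges G)"
  obtains p q where "adjacent G p q" "u = f p" "v = f q"
proof -
  from assms obtain e where e: "e \<in># edges G" "Upair u v = map_uprod f e" by auto
  obtain p q where pq: "e = Upair p q" by (cases e)
  then have "adjacent G p q" "adjacent G q p" using e adjacent_sym[of G p q] by (auto simp: adjacent_def)
  moreover have "u = f p \<and> v = f q \<or> u = f q \<and> v = f p" using e pq by auto
  ultimately show thesis using that by blast
qed

lemma map_adjacent:
  assumes "adjacent G p q"
  shows "Upair (f p) (f q) \<in># image_mset (map_uprod f) (edges G)"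
  using assms unfolding adjacent_def by (metis map_uprod_simps image_eqI set_image_mset)

lemma is_path_Cons:
  assumes "is_path G v p w" "u \<in> verts G" "adjacent G u v" "u \<notin> set p"
  shows "is_path G u (u # p) w"
  using assms unfolding is_path_def by (auto simp: successively_Cons)

lemma is_path_ConsD:
  assumes "is_path G u (u # p) w" "p \<noteq> []"
  shows "is_path G (hd p) p w" "adjacent G u (hd p)"
  using assms unfolding is_path_def by (auto simp: successively_Cons)

lemma is_path_suffix:
  assumes "is_path G v (p @ u # q) w"
  shows "is_path G u (u # q) w"
  using assms unfolding is_path_def by (auto simp: successively_append_iff)

lemma graph_dist_le: "is_path G u p v \<Longrightarrow> graph_dist G u v \<le> length p - 1"
  unfolding graph_dist_def by (rule Least_le) auto

lemma shortest_path_exists: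
  assumes "is_path G u p v"
  obtains q where "is_path G u q v" "length q - 1 = graph_dist G u v"
proof -
  have "\<exists>q. is_path G u q v \<and> length q - 1 = graph_dist G u v"
    unfolding graph_dist_def by (rule LeastI[of _ "length p - 1"]) (use assms in auto)
  then show thesis using that by blast
qed

text \<open>Along each edge the potential drops by at most 1, and it has to reach 0 at
  \<open>r\<close>.\<close>

lemma distance_potential_le_length:
  assumes "distance_potential G r f" "is_path G v p r"
  shows "f v \<le> length p - 1"
proof -
  \<comment> \<open>The claim is generalised to walks with any first vertex, because the first
    vertex changes at each step of the induction.\<close>
  have "f (hd p) \<le> length p - 1" if "p \<noteq> []" "last p = r" "successively (adjacent G) p" for p
    using that
  proof (induction p)
    case (Cons u p)
    show ?case
    proof (cases "p = []")
      case True
      then show ?thesis using Cons.prems assms by (simp add: distance_potential_def)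
    next
      case False
      then have "adjacent G u (hd p)" "f (hd p) \<le> length p - 1"
        using Cons by (auto simp: successively_Cons)
      moreover have "f u \<le> f (hd p) + 1"
        using \<open>adjacent G u (hd p)\<close> assms by (simp add: distance_potential_def)
      ultimately show ?thesis using False by (cases p) auto
    qed
  qed simp
  then show ?thesis using assms(2) by (auto simp: is_path_def)
qed

text \<open>Repeatedly step to a neighbour of potential one less. The bound on the potentials along
  the path is carried through the induction because it keeps the path simple: \<open>v\<close> lies
  strictly above every vertex of the path it is prepended to.\<close>

lemma distance_potential_descending_path:
  assumes "distance_potential G r f" "v \<in> verts G"
  shows "\<exists>p. is_path G v p r \<and> length p = f v + 1 \<and> (\<forall>u \<in> set p. f u \<le> f v)"
  using assms(2)
proof (induction "f v" arbitrary: v rule: less_induct)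
  case less
  show ?case
  proof (cases "v = r")
    case True
    then show ?thesis using assms(1) less.prems
      by (intro exI[of _ "[r]"]) (auto simp: is_path_def distance_potential_def)
  next
    case False
    then obtain u where u: "u \<in> verts G" "adjacent G v u" "f v = f u + 1"
      using assms(1) less.prems unfolding distance_potential_def by blast
    obtain p where p: "is_path G u p r" "length p = f u + 1" "\<forall>w \<in> set p. f w \<le> f u"
      using less.hyps[of u] u by auto
    have "v \<notin> set p" using p u by fastforce
    then have "is_path G v (v # p) r"
      using is_path_Cons[OF p(1) less.prems u(2)] by simp
    then show ?thesis using p u by (intro exI[of _ "v # p"]) fastforce
  qed
qed

lemma graph_dist_eq_potential:
  assumes "distance_potential G r f" "v \<in> verts G"
  shows "graph_dist G v r = f v"
proof -
  obtain p where p: "is_path G v p r" "length p = f v + 1"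
    using distance_potential_descending_path[OF assms] by blast
  obtain q where "is_path G v q r" "length q - 1 = graph_dist G v r"
    using shortest_path_exists[OF p(1)] by blast
  then show ?thesis
    using graph_dist_le[OF p(1)] p(2) distance_potential_le_length[OF assms(1)] by force
qed

text \<open>Needed for the seed alone; in the networks a potential is built directly and the
  distance is deduced from it.\<close>

lemma distance_potential_graph_dist:
  assumes "finite_multigraph G" "connected_multigraph G" "r \<in> verts G"
  shows "distance_potential G r (\<lambda>v. graph_dist G v r)"
  unfolding distance_potential_def
proof (intro conjI allI ballI impI)
  have "is_path G r [r] r" using assms(3) by (simp add: is_path_def)
  then show "graph_dist G r r = 0" using graph_dist_le by fastforce
next
  fix u v assume uv: "adjacent G u v"
  then have in_verts: "u \<in> verts G" "v \<in> verts G"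
    using assms(1) unfolding adjacent_def finite_multigraph_def by force+
  then obtain p0 where "is_path G v p0 r"
    using assms unfolding connected_multigraph_def by blast
  then obtain p where p: "is_path G v p r" "length p - 1 = graph_dist G v r"
    by (rule shortest_path_exists)
  show "graph_dist G u r \<le> graph_dist G v r + 1"
  \<comment> \<open>Prepending \<open>u\<close> would break distinctness if \<open>u\<close> already
    lies on the shortest path; in that case the suffix starting at \<open>u\<close> is itself a
    short enough path.\<close>
  proof (cases "u \<in> set p")
    case True
    then obtain p1 p2 where p12: "p = p1 @ u # p2" by (meson split_list)
    then have "is_path G u (u # p2) r" using p(1) is_path_suffix by metis
    from graph_dist_le[OF this] show ?thesis using p p12 by simp
  next
    case False
    from graph_dist_le[OF is_path_Cons[OF p(1) in_verts(1) uv False]] p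
    show ?thesis by (simp add: is_path_def)
  qed
next
  fix v assume v: "v \<in> verts G" "v \<noteq> r"
  then obtain p0 where "is_path G v p0 r"
    using assms unfolding connected_multigraph_def by blast
  then obtain p where p: "is_path G v p r" "length p - 1 = graph_dist G v r"
    by (rule shortest_path_exists)
  \<comment> \<open>The neighbour closer to \<open>r\<close> is the second vertex of a shortest
    path; it exists because \<open>v \<noteq> r\<close>.\<close>
  then obtain q where q: "p = v # q" "q \<noteq> []"
    using v(2) unfolding is_path_def by (cases p) (auto split: if_splits)
  have path: "is_path G (hd q) q r" and adj: "adjacent G v (hd q)"
    using is_path_ConsD[of G v q r] p q by auto
  have le: "graph_dist G (hd q) r + 1 \<le> graph_dist G v r"
    using graph_dist_le[OF path] p q by (cases q) auto
  have u: "hd q \<in> verts G" using path by (auto simp: is_path_def)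
  obtain s where s: "is_path G (hd q) s r" "length s - 1 = graph_dist G (hd q) r"
    using shortest_path_exists[OF path] by blast
  have "graph_dist G v r \<le> graph_dist G (hd q) r + 1"
  proof (cases "v \<in> set s")
    case True
    then obtain s1 s2 where s12: "s = s1 @ v # s2" by (meson split_list)
    then have "is_path G v (v # s2) r" using s(1) is_path_suffix by metis
    from graph_dist_le[OF this] show ?thesis using s s12 by simp
  next
    case False
    from graph_dist_le[OF is_path_Cons[OF s(1) v(1) adj False]] s
    show ?thesis by (simp add: is_path_def)
  qed
  then show "\<exists>u\<in>verts G. adjacent G v u \<and> graph_dist G v r = graph_dist G u r + 1"
    using u adj le by (intro bexI[of _ "hd q"]) auto
qed (use assms in simp)

section \<open>Uniform random subsets and expectations over finite supports\<close>

text \<open>Double counting: with \<open>k = Suc j\<close>, each element of \<open>V\<close> lies in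
  \<open>(card V - 1) choose j\<close> of the subsets, as removing it leaves a
  \<open>j\<close>-subset of the rest. The factor \<open>card V\<close> on the left lets binomial
  absorption apply without division.\<close>

lemma sum_over_subsets_of_card:
  fixes f :: "'b \<Rightarrow> real"
  assumes "finite V"
  shows "real (card V) * (\<Sum>L | L \<subseteq> V \<and> card L = k. \<Sum>x\<in>L. f x) =
         real k * real (card V choose k) * (\<Sum>x\<in>V. f x)"
proof (cases k)
  case 0
  have "(\<Sum>L | L \<subseteq> V \<and> card L = k. \<Sum>x\<in>L. f x) = 0"
  proof (rule sum.neutral, rule ballI)
    fix L assume "L \<in> {L. L \<subseteq> V \<and> card L = k}"
    then have "L = {}" using 0 assms finite_subset[of L V] by simp
    then show "(\<Sum>x\<in>L. f x) = 0" by simp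
  qed
  then show ?thesis using 0 by simp
next
  case (Suc j)
  let ?S = "{L. L \<subseteq> V \<and> card L = k}"
  have fin: "finite ?S" using assms by simp
  have count: "card {L \<in> ?S. x \<in> L} = (card V - 1) choose j" if "x \<in> V" for x
  proof -
    have "bij_betw (insert x) {B. B \<subseteq> V - {x} \<and> card B = j} {L \<in> ?S. x \<in> L}"
    proof (rule bij_betwI[where g = "\<lambda>L. L - {x}"])
      show "insert x \<in> {B. B \<subseteq> V - {x} \<and> card B = j} \<rightarrow> {L \<in> ?S. x \<in> L}"
      proof
        fix B assume B: "B \<in> {B. B \<subseteq> V - {x} \<and> card B = j}"
        then have "finite B" "x \<notin> B" using assms finite_subset[of B V] by auto
        then show "insert x B \<in> {L \<in> ?S. x \<in> L}" using B that Suc by auto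
      qed
      show "(\<lambda>L. L - {x}) \<in> {L \<in> ?S. x \<in> L} \<rightarrow> {B. B \<subseteq> V - {x} \<and> card B = j}"
        using Suc by auto
    qed auto
    then show ?thesis
      using n_subsets[of "V - {x}" j] assms that by (simp add: bij_betw_same_card[symmetric])
  qed
  have "(\<Sum>L\<in>?S. \<Sum>x\<in>L. f x) = (\<Sum>L\<in>?S. \<Sum>x\<in>V. if x \<in> L then f x else 0)"
  proof (rule sum.cong[OF refl])
    fix L assume "L \<in> ?S"
    then have "V \<inter> L = L" by blast
    then show "(\<Sum>x\<in>L. f x) = (\<Sum>x\<in>V. if x \<in> L then f x else 0)"
      using sum.inter_restrict[OF assms, of f L] by (simp only:)
  qed
  also have "\<dots> = (\<Sum>x\<in>V. \<Sum>L\<in>?S. if x \<in> L then f x else 0)" by (rule sum.swap)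
  also have "\<dots> = (\<Sum>x\<in>V. real ((card V - 1) choose j) * f x)"
  proof (rule sum.cong[OF refl])
    fix x assume "x \<in> V"
    have "(\<Sum>L\<in>?S. if x \<in> L then f x else 0) = (\<Sum>L\<in>{L \<in> ?S. x \<in> L}. f x)"
      by (rule sum.inter_filter[OF fin, symmetric])
    then show "(\<Sum>L\<in>?S. if x \<in> L then f x else 0) = real ((card V - 1) choose j) * f x"
      using count[OF \<open>x \<in> V\<close>] by simp
  qed
  finally have "(\<Sum>L\<in>?S. \<Sum>x\<in>L. f x) = real ((card V - 1) choose j) * (\<Sum>x\<in>V. f x)"
    by (simp add: sum_distrib_left)
  moreover have "real (card V) * real ((card V - 1) choose j) = real k * real (card V choose k)"
    using binomial_absorption[of j "card V"] Suc by (simp only: of_nat_mult[symmetric])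
  ultimately show ?thesis by (simp only: mult.assoc[symmetric])
qed

text \<open>By symmetry each element is chosen with probability \<open>k / card V\<close>. The bound
  on \<open>k\<close> ensures that there are subsets to choose from.\<close>

lemma expectation_sum_uniform_subset:
  fixes f :: "'b \<Rightarrow> real"
  assumes "finite V" "k \<le> card V" "V \<noteq> {}"
  shows "measure_pmf.expectation (pmf_of_set {L. L \<subseteq> V \<and> card L = k}) (\<lambda>L. \<Sum>x\<in>L. f x) =
         real k / real (card V) * (\<Sum>x\<in>V. f x)"
proof -
  let ?S = "{L. L \<subseteq> V \<and> card L = k}"
  have card: "card ?S = card V choose k" using assms by (simp add: n_subsets)
  have pos: "card V choose k > 0" "card V > 0" using assms by (auto simp: card_gt_0_iff)
  then have "?S \<noteq> {}" using card by (metis card.empty less_irrefl)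
  then have "measure_pmf.expectation (pmf_of_set ?S) (\<lambda>L. \<Sum>x\<in>L. f x) =
             (\<Sum>L\<in>?S. \<Sum>x\<in>L. f x) / real (card V choose k)"
    using assms card by (subst integral_pmf_of_set) auto
  moreover have "(\<Sum>L\<in>?S. \<Sum>x\<in>L. f x) = real k * real (card V choose k) * (\<Sum>x\<in>V. f x) / real (card V)"
    using sum_over_subsets_of_card[OF assms(1), where k = k and f = f] pos
    by (simp add: eq_divide_eq mult.commute)
  ultimately show ?thesis using pos by simp
qed

text \<open>Finite supports turn both sides into finite sums, so unbounded functions such as total
  depths are covered.\<close>

lemma expectation_bind_pmf_finite:
  fixes g :: "'b \<Rightarrow> real"
  assumes "finite (set_pmf p)" "\<And>x. x \<in> set_pmf p \<Longrightarrow> finite (set_pmf (f x))"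
  shows "measure_pmf.expectation (bind_pmf p f) g =
         measure_pmf.expectation p (\<lambda>x. measure_pmf.expectation (f x) g)"
  using assms by (subst pmf_expectation_bind[of "set_pmf p"]) (auto simp: integral_measure_pmf[of "set_pmf p"])

section \<open>Averages of null sequences\<close>

text \<open>Cesaro argument: the terms before \<open>N\<close> contribute at most a constant
  \<open>C\<close>, all later ones at most \<open>e / 2\<close> each.\<close>

lemma sum_null_sequence_smallo:
  fixes c :: "nat \<Rightarrow> real"
  assumes "c \<longlonglongrightarrow> 0"
  shows "(\<lambda>n. \<Sum>i<n. c i) \<in> o(\<lambda>n. real n)"
proof (rule landau_o.smallI)
  fix e :: real assume e: "e > 0"
  then obtain N where N: "\<And>i. i \<ge> N \<Longrightarrow> \<bar>c i\<bar> \<le> e / 2"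
    using LIMSEQ_D[OF assms, of "e / 2"] by (auto intro: less_imp_le)
  define C where "C = (\<Sum>i<N. \<bar>c i\<bar>)"
  have bound: "\<bar>\<Sum>i<n. c i\<bar> \<le> C + e / 2 * real n" for n
  proof -
    have "\<bar>\<Sum>i<n. c i\<bar> \<le> (\<Sum>i<n. \<bar>c i\<bar>)" by (rule sum_abs)
    also have "\<dots> \<le> (\<Sum>i<n. (if i < N then \<bar>c i\<bar> else 0) + e / 2)"
      using N e by (intro sum_mono) auto
    also have "\<dots> = (\<Sum>i\<in>{..<n} \<inter> {..<N}. \<bar>c i\<bar>) + e / 2 * real n"
      by (simp add: sum.distrib sum.inter_restrict)
    also have "(\<Sum>i\<in>{..<n} \<inter> {..<N}. \<bar>c i\<bar>) \<le> C"
      unfolding C_def by (rule sum_mono2) auto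
    finally show ?thesis by simp
  qed
  \<comment> \<open>From \<open>2 * C / e\<close> on, \<open>C\<close> fits into the remaining half
    of \<open>e * n\<close>.\<close>
  show "\<forall>\<^sub>F n in sequentially. norm (\<Sum>i<n. c i) \<le> e * norm (real n)"
    using eventually_ge_at_top[of "nat \<lceil>2 * C / e\<rceil>"]
  proof eventually_elim
    case (elim n)
    then have "2 * C / e \<le> real n" by linarith
    then have "C \<le> e / 2 * real n" using e by (simp add: field_simps)
    then show ?case using bound[of n] by simp
  qed
qed

section \<open>Depths under fusion of seed copies\<close>

locale hooking_seed =
  fixes G0 :: "'a multigraph" and h :: 'a
  assumes seed: "is_seed G0 h"
begin

lemma finite_seed: "finite (verts G0)" and hook_in_seed: "h \<in> verts G0"
  and card_seed: "card (verts G0) \<ge> 2"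
  using seed by (auto simp: is_seed_def finite_multigraph_def)

lemma seed_potential: "distance_potential G0 h (\<lambda>v. graph_dist G0 v h)"
  using seed by (intro distance_potential_graph_dist) (auto simp: is_seed_def)

text \<open>A name records the chain of latches back to the initial seed, and the seed distances are
  added along it. The value depends on the name alone and on no network, which expresses that later
  hooking leaves depths unchanged.\<close>

primrec vertex_depth :: "'a vertex \<Rightarrow> nat" where
  "vertex_depth (Orig v) = graph_dist G0 v h"
| "vertex_depth (Copy n x v) = vertex_depth x + graph_dist G0 v h"

lemma graph_dist_hook: "graph_dist G0 h h = 0"
  using seed_potential by (simp add: distance_potential_def)

text \<open>The fused hook obeys the same formula as the other vertices because its distance in the
  seed is 0.\<close>

lemma vertex_depth_copy_vertex:
  "vertex_depth (copy_vertex h n x v) = vertex_depth x + graph_dist G0 v h"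
  by (simp add: copy_vertex_def graph_dist_hook)

lemma initial_network_potential:
  "distance_potential (initial_network G0) (Orig h) vertex_depth"
  unfolding distance_potential_def
proof (intro conjI allI ballI impI)
  show "Orig h \<in> verts (initial_network G0)" by (simp add: initial_network_def hook_in_seed)
  show "vertex_depth (Orig h) = 0" by (simp add: graph_dist_hook)
next
  fix u v assume "adjacent (initial_network G0) u v"
  then obtain p q where "adjacent G0 p q" "u = Orig p" "v = Orig q"
    unfolding adjacent_def[of "initial_network G0"]
    by (auto simp: initial_network_def simp del: set_image_mset elim: adjacent_map_edges)
  then show "vertex_depth u \<le> vertex_depth v + 1"
    using seed_potential by (simp add: distance_potential_def)
next
  fix v assume "v \<in> verts (initial_network G0)" "v \<noteq> Orig h"
  then obtain p where p: "v = Orig p" "p \<in> verts G0" "p \<noteq> h" by (auto simp: initial_network_def)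
  then obtain q where q: "q \<in> verts G0" "adjacent G0 p q" "graph_dist G0 p h = graph_dist G0 q h + 1"
    using seed_potential unfolding distance_potential_def by blast
  have "adjacent (initial_network G0) v (Orig q)"
    using map_adjacent[OF q(2), of Orig] p by (simp add: adjacent_def initial_network_def)
  then show "\<exists>u\<in>verts (initial_network G0). adjacent (initial_network G0) v u \<and>
      vertex_depth v = vertex_depth u + 1"
    using p q by (intro bexI[of _ "Orig q"]) (auto simp: initial_network_def)
qed

lemma adjacent_fuse_copies:
  assumes "finite L"
  shows "adjacent (fuse_copies G0 h n L G) u v \<longleftrightarrow> adjacent G u v \<or>
    (\<exists>x\<in>L. Upair u v \<in># image_mset (map_uprod (copy_vertex h n x)) (edges G0))"
  using assms by (simp add: adjacent_def fuse_copies_def set_mset_sum del: set_image_mset)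

text \<open>Every edge is old or lies within one copy. On the copy at latch \<open>x\<close> the
  depth is the seed distance shifted by the constant \<open>vertex_depth x\<close>, so both local
  conditions carry over from the seed.\<close>

lemma fuse_copies_potential:
  assumes pot: "distance_potential G (Orig h) vertex_depth" and L: "L \<subseteq> verts G" "finite L"
  shows "distance_potential (fuse_copies G0 h n L G) (Orig h) vertex_depth"
  unfolding distance_potential_def
proof (intro conjI allI ballI impI)
  show "Orig h \<in> verts (fuse_copies G0 h n L G)"
    using pot by (simp add: fuse_copies_def distance_potential_def)
  show "vertex_depth (Orig h) = 0" by (simp add: graph_dist_hook)
next
  fix u v assume "adjacent (fuse_copies G0 h n L G) u v"
  then consider "adjacent G u v"
    | x where "Upair u v \<in># image_mset (map_uprod (copy_vertex h n x)) (edges G0)"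
    using adjacent_fuse_copies[OF L(2)] by blast
  then show "vertex_depth u \<le> vertex_depth v + 1"
  proof cases
    case 1
    then show ?thesis using pot by (simp add: distance_potential_def)
  next
    case 2
    then obtain p q where "adjacent G0 p q" "u = copy_vertex h n x p" "v = copy_vertex h n x q"
      by (rule adjacent_map_edges)
    then show ?thesis
      using seed_potential by (simp add: distance_potential_def vertex_depth_copy_vertex)
  qed
next
  fix v assume v: "v \<in> verts (fuse_copies G0 h n L G)" "v \<noteq> Orig h"
  show "\<exists>u\<in>verts (fuse_copies G0 h n L G). adjacent (fuse_copies G0 h n L G) v u \<and>
      vertex_depth v = vertex_depth u + 1"
  proof (cases "v \<in> verts G")
    case True
    then obtain u where "u \<in> verts G" "adjacent G v u" "vertex_depth v = vertex_depth u + 1"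
      using pot v(2) unfolding distance_potential_def by blast
    then show ?thesis
      using adjacent_fuse_copies[OF L(2)] by (intro bexI[of _ u]) (auto simp: fuse_copies_def)
  next
    case False
    then obtain x p where x: "x \<in> L" and p: "p \<in> verts G0" "v = copy_vertex h n x p"
      using v(1) by (auto simp: fuse_copies_def)
    \<comment> \<open>The hook of the copy is the latch itself, which is an old vertex.\<close>
    then have "p \<noteq> h" using False L by (auto simp: copy_vertex_def)
    then obtain q where q: "q \<in> verts G0" "adjacent G0 p q" "graph_dist G0 p h = graph_dist G0 q h + 1"
      using seed_potential p(1) unfolding distance_potential_def by blast
    have "adjacent (fuse_copies G0 h n L G) v (copy_vertex h n x q)"
      using map_adjacent[OF q(2), of "copy_vertex h n x"] x p adjacent_fuse_copies[OF L(2)] by blast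
    moreover have "copy_vertex h n x q \<in> verts (fuse_copies G0 h n L G)"
      using x q by (auto simp: fuse_copies_def)
    ultimately show ?thesis
      using p q by (intro bexI[of _ "copy_vertex h n x q"]) (auto simp: vertex_depth_copy_vertex)
  qed
qed

section \<open>Order and total depth after one hooking step\<close>

text \<open>The hook is left out since it is identified with the latch. With
  \<open>inj_Copy\<close>, counting and summing reduce to a product set.\<close>

definition new_vertices :: "nat \<Rightarrow> 'a vertex set \<Rightarrow> 'a vertex set" where
  "new_vertices n L = (\<lambda>(x, v). Copy n x v) ` (L \<times> (verts G0 - {h}))"

lemma inj_Copy: "inj_on (\<lambda>(x, v). Copy n x v) A"
  by (auto simp: inj_on_def)

lemma verts_fuse_copies:
  assumes "L \<subseteq> verts G"
  shows "verts (fuse_copies G0 h n L G) = verts G \<union> new_vertices n L"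
proof
  show "verts (fuse_copies G0 h n L G) \<subseteq> verts G \<union> new_vertices n L"
    using assms by (auto simp: fuse_copies_def copy_vertex_def new_vertices_def)
next
  have "Copy n x v \<in> copy_vertex h n x ` verts G0" if "v \<in> verts G0" "v \<noteq> h" for x v
    using that by (intro image_eqI[of _ _ v]) (auto simp: copy_vertex_def)
  then show "verts G \<union> new_vertices n L \<subseteq> verts (fuse_copies G0 h n L G)"
    by (auto simp: fuse_copies_def new_vertices_def)
qed

lemma finite_new_vertices: "finite L \<Longrightarrow> finite (new_vertices n L)"
  using finite_seed by (simp add: new_vertices_def)

lemma card_new_vertices: "card (new_vertices n L) = (card (verts G0) - 1) * card L"
  unfolding new_vertices_def
  using finite_seed hook_in_seed by (simp add: card_image[OF inj_Copy] card_cartesian_product)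

lemma sum_new_vertices:
  "(\<Sum>v\<in>new_vertices n L. real (vertex_depth v)) =
     (real (card (verts G0)) - 1) * (\<Sum>x\<in>L. real (vertex_depth x))
     + real (card L) * real (total_path_length G0 h)"
proof -
  \<comment> \<open>Omitting the hook does not change the sum, its depth being 0.\<close>
  have T0: "(\<Sum>v\<in>verts G0 - {h}. real (graph_dist G0 v h)) = real (total_path_length G0 h)"
    using finite_seed hook_in_seed
    by (simp add: total_path_length_def sum_diff1 graph_dist_hook)
  have "card (verts G0 - {h}) = card (verts G0) - 1"
    using finite_seed hook_in_seed by simp
  then have card: "real (card (verts G0 - {h})) = real (card (verts G0)) - 1"
    using card_seed by linarith
  have "(\<Sum>v\<in>new_vertices n L. real (vertex_depth v)) =
      (\<Sum>(x, v)\<in>L \<times> (verts G0 - {h}). real (vertex_depth x) + real (graph_dist G0 v h))"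
    unfolding new_vertices_def by (subst sum.reindex[OF inj_Copy]) (auto intro!: sum.cong)
  also have "\<dots> = (\<Sum>x\<in>L. \<Sum>v\<in>verts G0 - {h}. real (vertex_depth x) + real (graph_dist G0 v h))"
    by (rule sum.cartesian_product[symmetric])
  also have "\<dots> = (\<Sum>x\<in>L. (real (card (verts G0)) - 1) * real (vertex_depth x)
      + real (total_path_length G0 h))"
    by (simp only: sum.distrib T0 sum_constant card)
  finally show ?thesis by (simp add: sum.distrib sum_distrib_left)
qed

text \<open>Each latch brings all seed vertices but the hook, so the order is the same for all
  random outcomes. It is also the upper bound that \<open>building_sequence\<close> imposes on
  \<open>k n\<close>.\<close>

definition network_order :: "(nat \<Rightarrow> nat) \<Rightarrow> nat \<Rightarrow> nat" where
  "network_order k n = card (verts G0) + (card (verts G0) - 1) * (\<Sum>i<n. k i)"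

lemma real_network_order:
  "real (network_order k n) =
     real (card (verts G0)) + (real (card (verts G0)) - 1) * real (\<Sum>i<n. k i)"
proof -
  have "real (card (verts G0) - 1) = real (card (verts G0)) - 1" using card_seed by linarith
  then show ?thesis by (simp add: network_order_def)
qed

lemma network_order_pos: "network_order k n > 0"
  using card_seed by (simp add: network_order_def)

text \<open>Invariant of all possible outcomes. The last conjunct bounds the time stamps in the
  names, so that names stamped \<open>n\<close> are fresh in step \<open>n\<close>
  (\<open>is_network_disjoint_new\<close>).\<close>

definition is_network :: "(nat \<Rightarrow> nat) \<Rightarrow> nat \<Rightarrow> 'a vertex multigraph \<Rightarrow> bool" where
  "is_network k n G \<longleftrightarrow> finite (verts G) \<and> card (verts G) = network_order k n \<and>
     distance_potential G (Orig h) vertex_depth \<and> (\<forall>m x v. Copy m x v \<in> verts G \<longrightarrow> m < n)"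

lemma is_network_disjoint_new:
  assumes "is_network k n G"
  shows "verts G \<inter> new_vertices n L = {}"
  using assms by (auto simp: is_network_def new_vertices_def)

lemma is_network_initial: "is_network k 0 (initial_network G0)"
  using initial_network_potential finite_seed
  by (auto simp: is_network_def network_order_def initial_network_def card_image inj_on_def)

lemma is_network_fuse_copies:
  assumes "is_network k n G" "L \<subseteq> verts G" "card L = k n"
  shows "is_network k (Suc n) (fuse_copies G0 h n L G)"
proof -
  have "finite L" using assms finite_subset by (auto simp: is_network_def)
  then have fin: "finite L" "finite (new_vertices n L)" by (simp_all add: finite_new_vertices)
  have "card (verts G \<union> new_vertices n L) = network_order k (Suc n)"
    using assms fin is_network_disjoint_new[OF assms(1)]
    by (subst card_Un_disjoint)
       (auto simp: is_network_def card_new_vertices network_order_def algebra_simps)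
  moreover have "m < Suc n" if "Copy m x v \<in> verts G \<union> new_vertices n L" for m x v
    using that assms(1) by (force simp: is_network_def new_vertices_def intro: less_SucI)
  ultimately show ?thesis
    using assms fin fuse_copies_potential[of G L n]
    by (simp add: is_network_def verts_fuse_copies)
qed

lemma total_depth_fuse_copies:
  assumes "is_network k n G" "L \<subseteq> verts G"
  shows "(\<Sum>v\<in>verts (fuse_copies G0 h n L G). real (vertex_depth v)) =
     (\<Sum>v\<in>verts G. real (vertex_depth v))
     + (real (card (verts G0)) - 1) * (\<Sum>x\<in>L. real (vertex_depth x))
     + real (card L) * real (total_path_length G0 h)"
proof -
  have "finite (verts G)" "finite (new_vertices n L)"
    using assms finite_subset by (auto simp: is_network_def intro: finite_new_vertices)
  then show ?thesis
    using is_network_disjoint_new[OF assms(1)] assms(2)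
    by (simp add: verts_fuse_copies sum.union_disjoint sum_new_vertices)
qed

section \<open>Limit of the depth increments\<close>

text \<open>With \<open>K\<close> the sum of \<open>k i\<close> over \<open>i \<le> n\<close> and
  \<open>t\<close> the seed order, the next network has order \<open>t + (t - 1) * K\<close>. Divide
  numerator and denominator by \<open>K\<close>; the term \<open>a * b\<close> arises from
  \<open>t / K = (k n / K) * (t / k n)\<close>.\<close>

lemma depth_increment_tendsto:
  assumes k_pos: "\<And>n. k n \<ge> 1"
    and a: "(\<lambda>n. real (k n) / real (\<Sum>i\<le>n. k i)) \<longlonglongrightarrow> a"
    and b: "(\<lambda>n. real (card (verts G0)) / real (k n)) \<longlonglongrightarrow> b"
  shows "(\<lambda>n. real (k n) * real T / real (network_order k (Suc n))) \<longlonglongrightarrow>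
    a * real T / (real (card (verts G0)) - 1 + a * b)"
proof -
  let ?t = "real (card (verts G0))"
  let ?r = "\<lambda>n. real (k n) / real (\<Sum>i\<le>n. k i)"
  \<comment> \<open>Nonnegative limits keep the limiting denominator at least \<open>?t - 1\<close>,
    which is positive.\<close>
  have "a \<ge> 0" by (rule LIMSEQ_le_const[OF a]) (simp add: sum_nonneg)
  moreover have "b \<ge> 0" by (rule LIMSEQ_le_const[OF b]) auto
  ultimately have "a * b \<ge> 0" by simp
  then have "?t - 1 + a * b \<noteq> 0" using card_seed by linarith
  then have "(\<lambda>n. ?r n * real T / (?t - 1 + ?r n * (?t / real (k n)))) \<longlonglongrightarrow>
      a * real T / (?t - 1 + a * b)"
    using a b by (intro tendsto_intros) auto
  moreover have "?r n * real T / (?t - 1 + ?r n * (?t / real (k n))) =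
      real (k n) * real T / real (network_order k (Suc n))" for n
  proof -
    define K where "K = real (\<Sum>i\<le>n. k i)"
    have "k n \<le> (\<Sum>i\<le>n. k i)" by (rule member_le_sum) auto
    then have K: "K > 0" using k_pos[of n] by (simp add: K_def del: of_nat_sum)
    have kn: "real (k n) > 0" using k_pos[of n] by simp
    have "real (network_order k (Suc n)) = ?t + (?t - 1) * K"
      by (simp only: real_network_order K_def lessThan_Suc_atMost)
    also have "\<dots> = K * (?t - 1 + real (k n) / K * (?t / real (k n)))"
      using K kn by (simp add: field_simps)
    finally show ?thesis unfolding K_def[symmetric] using K by simp
  qed
  ultimately show ?thesis by (simp only:)
qed

section \<open>Recursion for the mean depth\<close>

context
  fixes k :: "nat \<Rightarrow> nat"
  assumes k_le: "\<And>n. k n \<le> network_order k n"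
begin

text \<open>\<open>pmf_of_set\<close> is the uniform law only on a finite nonempty set;
  \<open>k_le\<close> guarantees enough vertices for the choice of latches.\<close>

lemma latch_sets_finite_nonempty:
  assumes "is_network k n G"
  shows "finite {L. L \<subseteq> verts G \<and> card L = k n}" "{L. L \<subseteq> verts G \<and> card L = k n} \<noteq> {}"
proof -
  have G: "finite (verts G)" "k n \<le> card (verts G)"
    using assms k_le[of n] by (auto simp: is_network_def)
  show "finite {L. L \<subseteq> verts G \<and> card L = k n}" using G by simp
  obtain L where "L \<subseteq> verts G" "card L = k n"
    by (rule obtain_subset_with_card_n[OF G(2)])
  then show "{L. L \<subseteq> verts G \<and> card L = k n} \<noteq> {}" by blast
qed

lemma is_network_network: "G \<in> set_pmf (network G0 h k n) \<Longrightarrow> is_network k n G"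
proof (induction n arbitrary: G)
  case 0
  then show ?case by (simp add: is_network_initial)
next
  case (Suc n)
  then obtain G' L where G': "G' \<in> set_pmf (network G0 h k n)"
    and L: "L \<in> set_pmf (pmf_of_set {L. L \<subseteq> verts G' \<and> card L = k n})"
    and G: "G = fuse_copies G0 h n L G'" by auto
  have "is_network k n G'" using Suc.IH G' by blast
  then show ?case
    using L G latch_sets_finite_nonempty[of n G'] is_network_fuse_copies by auto
qed

text \<open>Makes every real function of the network integrable.\<close>

lemma finite_network: "finite (set_pmf (network G0 h k n))"
proof (induction n)
  case (Suc n)
  have "finite (set_pmf (pmf_of_set {L. L \<subseteq> verts G \<and> card L = k n}))"
    if "G \<in> set_pmf (network G0 h k n)" for G
    using latch_sets_finite_nonempty[OF is_network_network[OF that]] by simp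
  then show ?case using Suc by simp
qed simp

text \<open>As the order is deterministic, it can be divided out after taking the
  expectation.\<close>

definition mean_depth :: "nat \<Rightarrow> real" where
  "mean_depth n = measure_pmf.expectation (network G0 h k n)
     (\<lambda>G. \<Sum>v\<in>verts G. real (vertex_depth v)) / real (network_order k n)"

lemma expectation_node_depth:
  "measure_pmf.expectation (node_depth G0 h k n) real = mean_depth n"
proof -
  \<comment> \<open>The reference vertex belongs to every network, so a uniform choice of a vertex
    is meaningful.\<close>
  have network: "finite (verts G)" "verts G \<noteq> {}" "card (verts G) = network_order k n"
    if "G \<in> set_pmf (network G0 h k n)" for G
    using is_network_network[OF that] by (auto simp: is_network_def distance_potential_def)
  have "measure_pmf.expectation (node_depth G0 h k n) real =
    measure_pmf.expectation (network G0 h k n)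
      (\<lambda>G. measure_pmf.expectation (map_pmf (depth h G) (pmf_of_set (verts G))) real)"
    unfolding node_depth_def using finite_network network
    by (intro expectation_bind_pmf_finite) auto
  also have "\<dots> = measure_pmf.expectation (network G0 h k n)
      (\<lambda>G. (\<Sum>v\<in>verts G. real (vertex_depth v)) / real (network_order k n))"
  proof (intro integral_cong_AE)
    show "AE G in measure_pmf (network G0 h k n).
       measure_pmf.expectation (map_pmf (depth h G) (pmf_of_set (verts G))) real =
       (\<Sum>v\<in>verts G. real (vertex_depth v)) / real (network_order k n)"
    proof (rule AE_pmfI)
      fix G assume G: "G \<in> set_pmf (network G0 h k n)"
      \<comment> \<open>Only networks of positive probability matter; on these
        \<open>vertex_depth\<close> is a potential and hence the distance.\<close>
      have "depth h G v = vertex_depth v" if "v \<in> verts G" for v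
        using is_network_network[OF G] graph_dist_eq_potential that
        by (auto simp: depth_def is_network_def)
      then show "measure_pmf.expectation (map_pmf (depth h G) (pmf_of_set (verts G))) real =
         (\<Sum>v\<in>verts G. real (vertex_depth v)) / real (network_order k n)"
        using network[OF G] by (simp add: integral_pmf_of_set)
    qed
  qed auto
  finally show ?thesis by (simp add: mean_depth_def)
qed

lemma expectation_total_depth_step:
  assumes "is_network k n G"
  shows "measure_pmf.expectation
      (map_pmf (\<lambda>L. fuse_copies G0 h n L G) (pmf_of_set {L. L \<subseteq> verts G \<and> card L = k n}))
      (\<lambda>G'. \<Sum>v\<in>verts G'. real (vertex_depth v)) =
    real (network_order k (Suc n)) / real (network_order k n) * (\<Sum>v\<in>verts G. real (vertex_depth v))
    + real (k n) * real (total_path_length G0 h)"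
proof -
  let ?P = "pmf_of_set {L. L \<subseteq> verts G \<and> card L = k n}"
  let ?S = "\<Sum>v\<in>verts G. real (vertex_depth v)"
  let ?T = "real (k n) * real (total_path_length G0 h)"
  let ?t = "real (card (verts G0)) - 1"
  have set: "set_pmf ?P = {L. L \<subseteq> verts G \<and> card L = k n}"
    using latch_sets_finite_nonempty[OF assms] by simp
  have G: "finite (verts G)" "card (verts G) = network_order k n" "verts G \<noteq> {}"
    using assms by (auto simp: is_network_def distance_potential_def)
  have int: "integrable (measure_pmf ?P) f" for f :: "_ \<Rightarrow> real"
    using set latch_sets_finite_nonempty[OF assms] by (intro integrable_measure_pmf_finite) simp
  have "measure_pmf.expectation (map_pmf (\<lambda>L. fuse_copies G0 h n L G) ?P)
      (\<lambda>G'. \<Sum>v\<in>verts G'. real (vertex_depth v)) =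
    measure_pmf.expectation ?P (\<lambda>L. ?S + ?t * (\<Sum>x\<in>L. real (vertex_depth x)) + ?T)"
    using set total_depth_fuse_copies[OF assms]
    by (auto intro!: integral_cong_AE AE_pmfI)
  also have "\<dots> = ?S + ?t * (real (k n) / real (network_order k n) * ?S) + ?T"
    using int G k_le[of n] expectation_sum_uniform_subset[of "verts G" "k n" "\<lambda>x. real (vertex_depth x)"]
    by simp
  also have "\<dots> = (real (network_order k n) + ?t * real (k n)) / real (network_order k n) * ?S + ?T"
    using network_order_pos[of k n] by (simp add: field_simps)
  \<comment> \<open>The step adds \<open>?t\<close> vertices per latch, so the numerator is the next
    order.\<close>
  also have "real (network_order k n) + ?t * real (k n) = real (network_order k (Suc n))"
    by (simp add: real_network_order algebra_simps)
  finally show ?thesis .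
qed

text \<open>Division by the next order cancels the growth factor \<open>?N (Suc n) / ?N n\<close>,
  which makes the recursion for total depths additive.\<close>

lemma mean_depth_Suc:
  "mean_depth (Suc n) =
     mean_depth n + real (k n) * real (total_path_length G0 h) / real (network_order k (Suc n))"
proof -
  let ?S = "\<lambda>G. \<Sum>v\<in>verts G. real (vertex_depth v)"
  let ?N = "\<lambda>n. real (network_order k n)"
  have int: "integrable (measure_pmf (network G0 h k n)) f" for f :: "_ \<Rightarrow> real"
    using finite_network by (rule integrable_measure_pmf_finite)
  have "measure_pmf.expectation (network G0 h k (Suc n)) ?S =
    measure_pmf.expectation (network G0 h k n) (\<lambda>G. measure_pmf.expectation
      (map_pmf (\<lambda>L. fuse_copies G0 h n L G) (pmf_of_set {L. L \<subseteq> verts G \<and> card L = k n})) ?S)"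
    unfolding network.simps using finite_network is_network_network latch_sets_finite_nonempty
    by (intro expectation_bind_pmf_finite) auto
  also have "\<dots> = measure_pmf.expectation (network G0 h k n)
      (\<lambda>G. ?N (Suc n) / ?N n * ?S G + real (k n) * real (total_path_length G0 h))"
    using expectation_total_depth_step is_network_network
    by (intro integral_cong_AE AE_pmfI) auto
  also have "\<dots> = ?N (Suc n) / ?N n * measure_pmf.expectation (network G0 h k n) ?S
      + real (k n) * real (total_path_length G0 h)"
    using int by simp
  finally show ?thesis
    using network_order_pos[of k n] network_order_pos[of k "Suc n"]
    by (simp add: mean_depth_def field_simps)
qed

lemma mean_depth_eq_sum:
  "mean_depth n = mean_depth 0
     + (\<Sum>i<n. real (k i) * real (total_path_length G0 h) / real (network_order k (Suc i)))"
  by (induction n) (simp_all add: mean_depth_Suc)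

end

end

section \<open>Asymptotics of the mean depth\<close>

theorem corollary5p2:
  fixes G0 :: "'a multigraph" and h :: 'a and k :: "nat \<Rightarrow> nat"
    and \<tau>0 T0 :: nat and a b :: real
  assumes "is_seed G0 h"
    and "\<tau>0 = card (verts G0)"
    and "T0 = total_path_length G0 h"
    and "building_sequence \<tau>0 k"
    and "(\<lambda>n. real (k n) / real (\<Sum>i\<le>n. k i)) \<longlonglongrightarrow> a"
    and "(\<lambda>n. real \<tau>0 / real (k n)) \<longlonglongrightarrow> b"
  shows "(\<lambda>n. measure_pmf.expectation (node_depth G0 h k n) real
            - a * real T0 / (real \<tau>0 - 1 + a * b) * real n) \<in> o(\<lambda>n. real n)"
proof -
  interpret hooking_seed G0 h by unfold_locales fact
  have k_le: "k n \<le> network_order k n" and k_pos: "k n \<ge> 1" for n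
    using assms(2,4) by (auto simp: building_sequence_def network_order_def)
  define l where "l = a * real T0 / (real \<tau>0 - 1 + a * b)"
  define c where "c n = real (k n) * real T0 / real (network_order k (Suc n))" for n
  have "c \<longlonglongrightarrow> l"
    unfolding c_def l_def using depth_increment_tendsto[OF k_pos, where a = a and b = b and T = T0] assms by simp
  then have "(\<lambda>n. c n - l) \<longlonglongrightarrow> 0" by (rule LIM_zero)
  then have "(\<lambda>n. \<Sum>i<n. c i - l) \<in> o(\<lambda>n. real n)" by (rule sum_null_sequence_smallo)
  moreover have "(\<lambda>n. mean_depth k 0) \<in> o(\<lambda>n. real n)"
    
  proof (rule smalloI_tendsto)
    show "(\<lambda>n. mean_depth k 0 / real n) \<longlonglongrightarrow> 0" by (rule lim_const_over_n)
    \<comment> \<open>Eventually only, because \<open>real n\<close> vanishes at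
      \<open>n = 0\<close>.\<close>
    show "\<forall>\<^sub>F n in sequentially. real n \<noteq> 0"
      using eventually_gt_at_top[of "0::nat"] by eventually_elim simp
  qed
  ultimately have "(\<lambda>n. mean_depth k 0 + (\<Sum>i<n. c i - l)) \<in> o(\<lambda>n. real n)"
    by (intro sum_in_smallo)
  \<comment> \<open>Subtracting \<open>l\<close> from each of the \<open>n\<close> increments
    accounts for \<open>l * real n\<close>.\<close>
  moreover have "measure_pmf.expectation (node_depth G0 h k n) real - l * real n =
      mean_depth k 0 + (\<Sum>i<n. c i - l)" for n
    using expectation_node_depth[OF k_le, of n] mean_depth_eq_sum[OF k_le, of n] assms(3)
    by (simp add: c_def sum_subtractf)
  ultimately show ?thesis by (simp add: l_def)
qed

end
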